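(* Let ${\sf V}=({\sf V},\otimes,{\sf k})$ be a quantale in which every element is the supremum of a set of coprime elements. For a ${\sf V}$-valued closure space $(X,c)$ and $A\subseteq X$, let $\mathrm{FinCov}(A)$ be the set of finite strings $\vec M=(M_1,\dots,M_m)$ of subsets of $X$ with $M_1\cup\dots\cup M_m=A$ (the empty string, $m=0$, being allowed exactly when $A=\emptyset$), write $(c\vec M)(x)=(cM_1)(x)\vee\dots\vee(cM_m)(x)$ (which is $\bot$ for the empty string), and define $c^+:{\sf P}X\to{\sf V}^X$ by $$(c^+A)(x)=\bigwedge_{\vec M\in \mathrm{FinCov}(A)}(c\vec M)(x).$$ Then $(X,c)\mapsto (X,c^+)$ (identity on maps) is a functor ${\sf V}\text{-}\mathbf{Cls}\to{\sf V}\text{-}\mathbf{Top}$ that is right adjoint to the inclusion ${\sf V}\text{-}\mathbf{Top}\hookrightarrow{\sf V}\text{-}\mathbf{Cls}$, commutes with the underlying-set functors, and has counits given by identity maps. Explicitly: for every ${\sf V}$-valued closure space $(X,c)$, $(X,c^+)$ is a ${\sf V}$-valued topological space, $c^+\le c$ pointwise (so the identity map $(X,c^+)\to(X,c)$ is continuous), and for every ${\sf V}$-valued topological space $(Y,d)$, every continuous map $g:(Y,d)\to(X,c)$ is also continuous as a map $(Y,d)\to(X,c^+)$.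
   Context: A quantale ${\sf V}=({\sf V},\otimes,{\sf k})$ is a complete lattice with a (not necessarily commutative) monoid structure $(\otimes,{\sf k})$ such that $\otimes$ preserves arbitrary suprema in each variable; no relation between ${\sf k}$ and $\top,\bot$ is assumed. An element $p$ of ${\sf V}$ is coprime if $p>\bot$ and, for all $u,v$, $p\le u\vee v$ implies $p\le u$ or $p\le v$. ${\sf P}X$ is the power set of $X$ and ${\sf V}^X$ the set of maps $X\to{\sf V}$, ordered pointwise. A ${\sf V}$-valued closure space is a set $X$ with a map $c:{\sf P}X\to{\sf V}^X$ such that (R) ${\sf k}\le (cA)(x)$ whenever $x\in A\subseteq X$, and (T) $\big(\bigwedge_{y\in B}(cA)(y)\big)\otimes (cB)(x)\le (cA)(x)$ for all $A,B\subseteq X$, $x\in X$. It is a ${\sf V}$-valued topological space if moreover (A) $(c\emptyset)(x)=\bot$ and $c(A\cup B)(x)=(cA)(x)\vee(cB)(x)$ for all $A,B\subseteq X$, $x\in X$. A map $f:(X,c)\to(Y,d)$ is continuous if $(cA)(x)\le d(fA)(fx)$ for all $A\subseteq X$, $x\in X$. ${\sf V}\text{-}\mathbf{Cls}$ is the category of ${\sf V}$-valued closure spaces and continuous maps, and ${\sf V}\text{-}\mathbf{Top}$ its full subcategory of ${\sf V}$-valued topological spaces. *)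

theory Defs
  imports "HOL-Library.FuncSet"
begin

locale quantale = monoid tensor unit
  for tensor :: "'v::complete_lattice \<Rightarrow> 'v \<Rightarrow> 'v" and unit :: 'v +
  assumes tensor_Sup_left: "tensor (Sup S) v = (SUP u\<in>S. tensor u v)"
    and tensor_Sup_right: "tensor u (Sup S) = (SUP v\<in>S. tensor u v)"

definition coprime_element :: "'v::complete_lattice \<Rightarrow> bool" where
  "coprime_element p \<longleftrightarrow> bot < p \<and> (\<forall>u v. p \<le> sup u v \<longrightarrow> p \<le> u \<or> p \<le> v)"

text \<open>
  The underlying set \<open>X\<close> is an arbitrary (possibly empty) subset of a type. Structures and maps are
  extensional (\<open>undefined\<close> outside their domain), so that equality in HOL is equality of maps.
\<close>

definition V_closure_space ::
  "('v::complete_lattice \<Rightarrow> 'v \<Rightarrow> 'v) \<Rightarrow> 'v \<Rightarrow> 'a set \<Rightarrow> ('a set \<Rightarrow> 'a \<Rightarrow> 'v) \<Rightarrow> bool"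
where
  "V_closure_space tensor k X c \<longleftrightarrow>
     c \<in> Pow X \<rightarrow>\<^sub>E (X \<rightarrow>\<^sub>E UNIV) \<and>
     (\<forall>A x. A \<subseteq> X \<longrightarrow> x \<in> A \<longrightarrow> k \<le> c A x) \<and>
     (\<forall>A B x. A \<subseteq> X \<longrightarrow> B \<subseteq> X \<longrightarrow> x \<in> X \<longrightarrow> tensor (INF y\<in>B. c A y) (c B x) \<le> c A x)"

definition V_topological_space ::
  "('v::complete_lattice \<Rightarrow> 'v \<Rightarrow> 'v) \<Rightarrow> 'v \<Rightarrow> 'a set \<Rightarrow> ('a set \<Rightarrow> 'a \<Rightarrow> 'v) \<Rightarrow> bool"
where
  "V_topological_space tensor k X c \<longleftrightarrow>
     V_closure_space tensor k X c \<and>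
     (\<forall>x\<in>X. c {} x = bot) \<and>
     (\<forall>A B x. A \<subseteq> X \<longrightarrow> B \<subseteq> X \<longrightarrow> x \<in> X \<longrightarrow> c (A \<union> B) x = sup (c A x) (c B x))"

definition V_continuous ::
  "'a set \<Rightarrow> ('a set \<Rightarrow> 'a \<Rightarrow> 'v::complete_lattice) \<Rightarrow> 'b set \<Rightarrow> ('b set \<Rightarrow> 'b \<Rightarrow> 'v) \<Rightarrow> ('a \<Rightarrow> 'b) \<Rightarrow> bool"
where
  "V_continuous X c Y d f \<longleftrightarrow>
     f \<in> X \<rightarrow>\<^sub>E Y \<and> (\<forall>A x. A \<subseteq> X \<longrightarrow> x \<in> X \<longrightarrow> c A x \<le> d (f ` A) (f x))"

definition FinCov :: "'a set \<Rightarrow> 'a set \<Rightarrow> 'a set list set" where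
  "FinCov X A = {Ms \<in> lists (Pow X). \<Union> (set Ms) = A}"

definition closure_plus ::
  "'a set \<Rightarrow> ('a set \<Rightarrow> 'a \<Rightarrow> 'v::complete_lattice) \<Rightarrow> ('a set \<Rightarrow> 'a \<Rightarrow> 'v)" where
  "closure_plus X c =
     (\<lambda>A\<in>Pow X. \<lambda>x\<in>X. INF Ms\<in>FinCov X A. SUP M\<in>set Ms. c M x)"

text \<open>
  Hom-sets need not be disjoint, so composition and the action of a functor on morphisms take
  the objects involved as arguments: \<open>Comp C a b c g f\<close> is the composite of \<open>f : a \<rightarrow> b\<close>
  with \<open>g : b \<rightarrow> c\<close>.
\<close>

record ('o, 'm) cat =
  Obj :: "'o set"
  Hom :: "'o \<Rightarrow> 'o \<Rightarrow> 'm set"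
  Ident :: "'o \<Rightarrow> 'm"
  Comp :: "'o \<Rightarrow> 'o \<Rightarrow> 'o \<Rightarrow> 'm \<Rightarrow> 'm \<Rightarrow> 'm"

locale category =
  fixes C :: "('o, 'm) cat"
  assumes ident_in_hom: "a \<in> Obj C \<Longrightarrow> Ident C a \<in> Hom C a a"
    and comp_in_hom:
      "\<lbrakk>a \<in> Obj C; b \<in> Obj C; c \<in> Obj C; f \<in> Hom C a b; g \<in> Hom C b c\<rbrakk>
        \<Longrightarrow> Comp C a b c g f \<in> Hom C a c"
    and comp_ident_right:
      "\<lbrakk>a \<in> Obj C; b \<in> Obj C; f \<in> Hom C a b\<rbrakk> \<Longrightarrow> Comp C a a b f (Ident C a) = f"
    and comp_ident_left:
      "\<lbrakk>a \<in> Obj C; b \<in> Obj C; f \<in> Hom C a b\<rbrakk> \<Longrightarrow> Comp C a b b (Ident C b) f = f"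
    and comp_assoc:
      "\<lbrakk>a \<in> Obj C; b \<in> Obj C; c \<in> Obj C; d \<in> Obj C;
        f \<in> Hom C a b; g \<in> Hom C b c; h \<in> Hom C c d\<rbrakk>
        \<Longrightarrow> Comp C a c d h (Comp C a b c g f) = Comp C a b d (Comp C b c d h g) f"

record ('o1, 'm1, 'o2, 'm2) ftor =
  FObj :: "'o1 \<Rightarrow> 'o2"
  FMor :: "'o1 \<Rightarrow> 'o1 \<Rightarrow> 'm1 \<Rightarrow> 'm2"

locale is_functor = dom: category C + cod: category D
  for C :: "('o1, 'm1) cat" and D :: "('o2, 'm2) cat" and F :: "('o1, 'm1, 'o2, 'm2) ftor" +
  assumes FObj_in: "a \<in> Obj C \<Longrightarrow> FObj F a \<in> Obj D"
    and FMor_in: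
      "\<lbrakk>a \<in> Obj C; b \<in> Obj C; f \<in> Hom C a b\<rbrakk>
        \<Longrightarrow> FMor F a b f \<in> Hom D (FObj F a) (FObj F b)"
    and FMor_ident: "a \<in> Obj C \<Longrightarrow> FMor F a a (Ident C a) = Ident D (FObj F a)"
    and FMor_comp:
      "\<lbrakk>a \<in> Obj C; b \<in> Obj C; c \<in> Obj C; f \<in> Hom C a b; g \<in> Hom C b c\<rbrakk>
        \<Longrightarrow> FMor F a c (Comp C a b c g f)
            = Comp D (FObj F a) (FObj F b) (FObj F c) (FMor F b c g) (FMor F a b f)"

definition id_functor :: "('o, 'm, 'o, 'm) ftor" where
  "id_functor = \<lparr>FObj = (\<lambda>a. a), FMor = (\<lambda>a b f. f)\<rparr>"

definition comp_functor ::
  "('o2, 'm2, 'o3, 'm3) ftor \<Rightarrow> ('o1, 'm1, 'o2, 'm2) ftor \<Rightarrow> ('o1, 'm1, 'o3, 'm3) ftor" where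
  "comp_functor G F =
     \<lparr>FObj = (\<lambda>a. FObj G (FObj F a)),
      FMor = (\<lambda>a b f. FMor G (FObj F a) (FObj F b) (FMor F a b f))\<rparr>"

definition functor_eq ::
  "('o1, 'm1) cat \<Rightarrow> ('o1, 'm1, 'o2, 'm2) ftor \<Rightarrow> ('o1, 'm1, 'o2, 'm2) ftor \<Rightarrow> bool" where
  "functor_eq C F G \<longleftrightarrow>
     (\<forall>a\<in>Obj C. FObj F a = FObj G a) \<and>
     (\<forall>a\<in>Obj C. \<forall>b\<in>Obj C. \<forall>f\<in>Hom C a b. FMor F a b f = FMor G a b f)"

locale natural_transformation = source: is_functor C D F + target: is_functor C D G
  for C :: "('o1, 'm1) cat" and D :: "('o2, 'm2) cat"
    and F G :: "('o1, 'm1, 'o2, 'm2) ftor" and \<tau> :: "'o1 \<Rightarrow> 'm2" +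
  assumes component_in: "a \<in> Obj C \<Longrightarrow> \<tau> a \<in> Hom D (FObj F a) (FObj G a)"
    and naturality:
      "\<lbrakk>a \<in> Obj C; b \<in> Obj C; f \<in> Hom C a b\<rbrakk>
        \<Longrightarrow> Comp D (FObj F a) (FObj F b) (FObj G b) (\<tau> b) (FMor F a b f)
          = Comp D (FObj F a) (FObj G a) (FObj G b) (FMor G a b f) (\<tau> a)"

text \<open>\<open>F : C \<rightarrow> D\<close> is left adjoint to \<open>G : D \<rightarrow> C\<close>, with unit \<open>\<eta>\<close> and counit \<open>\<epsilon>\<close>.\<close>

locale adjunction =
  left: is_functor C D F + right: is_functor D C G +
  unit: natural_transformation C C id_functor "comp_functor G F" \<eta> +
  counit: natural_transformation D D "comp_functor F G" id_functor \<epsilon>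
  for C :: "('o1, 'm1) cat" and D :: "('o2, 'm2) cat"
    and F :: "('o1, 'm1, 'o2, 'm2) ftor" and G :: "('o2, 'm2, 'o1, 'm1) ftor"
    and \<eta> :: "'o1 \<Rightarrow> 'm1" and \<epsilon> :: "'o2 \<Rightarrow> 'm2" +
  assumes triangle_left:
      "a \<in> Obj C \<Longrightarrow>
        Comp D (FObj F a) (FObj F (FObj G (FObj F a))) (FObj F a)
          (\<epsilon> (FObj F a)) (FMor F a (FObj G (FObj F a)) (\<eta> a))
        = Ident D (FObj F a)"
    and triangle_right:
      "b \<in> Obj D \<Longrightarrow>
        Comp C (FObj G b) (FObj G (FObj F (FObj G b))) (FObj G b)
          (FMor G (FObj F (FObj G b)) b (\<epsilon> b)) (\<eta> (FObj G b))
        = Ident C (FObj G b)"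

text \<open>
  The objects live over the subsets of the type \<open>'a\<close>, which plays the role of a universe of points.
\<close>

type_synonym ('a, 'v) space = "'a set \<times> ('a set \<Rightarrow> 'a \<Rightarrow> 'v)"

definition Set_cat :: "('a set, 'a \<Rightarrow> 'a) cat" where
  "Set_cat =
     \<lparr>Obj = UNIV,
      Hom = (\<lambda>X Y. X \<rightarrow>\<^sub>E Y),
      Ident = (\<lambda>X. \<lambda>x\<in>X. x),
      Comp = (\<lambda>X Y Z g f. compose X g f)\<rparr>"

definition V_Cls ::
  "('v::complete_lattice \<Rightarrow> 'v \<Rightarrow> 'v) \<Rightarrow> 'v \<Rightarrow> (('a, 'v) space, 'a \<Rightarrow> 'a) cat" where
  "V_Cls tensor k =
     \<lparr>Obj = {(X, c). V_closure_space tensor k X c},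
      Hom = (\<lambda>(X, c) (Y, d). {f. V_continuous X c Y d f}),
      Ident = (\<lambda>(X, c). \<lambda>x\<in>X. x),
      Comp = (\<lambda>(X, c) _ _ g f. compose X g f)\<rparr>"

definition V_Top ::
  "('v::complete_lattice \<Rightarrow> 'v \<Rightarrow> 'v) \<Rightarrow> 'v \<Rightarrow> (('a, 'v) space, 'a \<Rightarrow> 'a) cat" where
  "V_Top tensor k = (V_Cls tensor k)\<lparr>Obj := {(X, c). V_topological_space tensor k X c}\<rparr>"

definition inclusion_functor :: "(('a, 'v) space, 'a \<Rightarrow> 'a, ('a, 'v) space, 'a \<Rightarrow> 'a) ftor" where
  "inclusion_functor = \<lparr>FObj = (\<lambda>S. S), FMor = (\<lambda>S T f. f)\<rparr>"

definition underlying_functor :: "(('a, 'v) space, 'a \<Rightarrow> 'a, 'a set, 'a \<Rightarrow> 'a) ftor" where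
  "underlying_functor = \<lparr>FObj = fst, FMor = (\<lambda>S T f. f)\<rparr>"

definition plus_functor ::
  "(('a, 'v::complete_lattice) space, 'a \<Rightarrow> 'a, ('a, 'v) space, 'a \<Rightarrow> 'a) ftor" where
  "plus_functor = \<lparr>FObj = (\<lambda>(X, c). (X, closure_plus X c)), FMor = (\<lambda>S T f. f)\<rparr>"

end

theory Submission
  imports Defs
begin

text \<open>
  For transitivity of \<open>c\<^sup>+\<close>, write \<open>u = (\<And>y\<in>B. c\<^sup>+ A y)\<close> as a supremum of coprimes \<open>p\<close>. Given a
  finite cover \<open>M\<^sub>1, \<dots>, M\<^sub>m\<close> of \<open>A\<close>, coprimality splits \<open>B\<close> into the finitely many sets
  \<open>N\<^sub>i = {y\<in>B. p \<le> c M\<^sub>i y}\<close>, and transitivity of \<open>c\<close> yields \<open>p \<otimes> c N\<^sub>i x \<le> c M\<^sub>i x\<close>. Coprimes also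
  supply the distributivity behind \<open>c\<^sup>+ (A \<union> B) x \<le> c\<^sup>+ A x \<squnion> c\<^sup>+ B x\<close>. The universal property holds
  because a finite cover of \<open>g ` A\<close> pulls back along \<open>g\<close> to a finite cover of \<open>A\<close>, over which the
  structure of a topological space is finitely additive.
\<close>

section \<open>Coprime elements\<close>

lemma coprime_le_SUP_finite:
  assumes "coprime_element p" "finite I" "p \<le> (SUP i\<in>I. f i)"
  shows "\<exists>i\<in>I. p \<le> f i"
  using assms(2,3)
proof (induction I rule: finite_induct)
  \<comment> \<open>The empty supremum is \<open>bot\<close>, which \<open>bot < p\<close> excludes.
    In the transitivity proof below this is what handles the empty string: it forces
    \<open>B\<close> to be empty.\<close>
  case empty
  then show ?case
    using assms(1) by (auto simp: coprime_element_def bot_unique)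
next
  case (insert i I)
  then show ?case
    using assms(1) by (auto simp: coprime_element_def)
qed

text \<open>Turns generation by coprimes into a test for inequalities: \<open>u\<close> is a
  supremum of coprimes, each of which lies below \<open>u\<close> and hence, by assumption, below
  \<open>v\<close>.\<close>

lemma le_by_coprimes:
  fixes u v :: "'v::complete_lattice"
  assumes gen: "\<forall>u::'v. \<exists>S. (\<forall>p\<in>S. coprime_element p) \<and> u = Sup S"
    and "\<And>p. coprime_element p \<Longrightarrow> p \<le> u \<Longrightarrow> p \<le> v"
  shows "u \<le> v"
proof -
  obtain S where "\<forall>p\<in>S. coprime_element p" "u = Sup S"
    using gen by blast
  with assms(2) show ?thesis
    by (auto intro!: Sup_least Sup_upper)
qed

section \<open>Monotonicity and finite additivity of closure structures\<close>

lemma V_closure_space_reflexive: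
  assumes "V_closure_space tensor k X c" "A \<subseteq> X" "x \<in> A"
  shows "k \<le> c A x"
  using assms unfolding V_closure_space_def by blast

lemma V_closure_space_transitive:
  assumes "V_closure_space tensor k X c" "A \<subseteq> X" "B \<subseteq> X" "x \<in> X"
  shows "tensor (INF y\<in>B. c A y) (c B x) \<le> c A x"
  using assms unfolding V_closure_space_def by blast

context quantale
begin

lemma tensor_mono_left:
  assumes "u \<le> u'"
  shows "tensor u v \<le> tensor u' v"
proof -
  \<comment> \<open>Preservation of the two-element supremum of \<open>{u, u'}\<close>, which is
    \<open>u'\<close>; the order is then read off from \<open>sup\<close>.\<close>
  have "sup (tensor u v) (tensor u' v) = tensor u' v"
    using tensor_Sup_left[of "{u, u'}" v] assms by (simp add: sup_absorb2)
  then show ?thesis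
    by (simp add: le_iff_sup)
qed

lemma tensor_mono_right:
  assumes "v \<le> v'"
  shows "tensor u v \<le> tensor u v'"
proof -
  have "sup (tensor u v) (tensor u v') = tensor u v'"
    using tensor_Sup_right[of u "{v, v'}"] assms by (simp add: sup_absorb2)
  then show ?thesis
    by (simp add: le_iff_sup)
qed

text \<open>By reflexivity \<open>unit\<close> is a lower bound of \<open>c B\<close> on
  \<open>A\<close>. Transitivity with \<open>A\<close> as the intermediate set therefore absorbs
  \<open>c A x\<close> into \<open>c B x\<close>, the tensor factor being at least
  \<open>unit\<close>.\<close>

lemma closure_mono:
  assumes c: "V_closure_space tensor unit X c" and "A \<subseteq> B" "B \<subseteq> X" "x \<in> X"
  shows "c A x \<le> c B x"
proof -
  have "unit \<le> (INF y\<in>A. c B y)"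
    using V_closure_space_reflexive[OF c] assms(2,3) by (auto intro: INF_greatest)
  then have "c A x \<le> tensor (INF y\<in>A. c B y) (c A x)"
    using tensor_mono_left[of unit _ "c A x"] by simp
  also have "\<dots> \<le> c B x"
    using assms(2-4) by (intro V_closure_space_transitive[OF c]) auto
  finally show ?thesis .
qed

text \<open>The family \<open>N\<close> is kept general because the universal property applies this
  to preimages of the terms of a cover. The empty list rests on \<open>d {} x = bot\<close>.\<close>

lemma topological_finite_additive:
  assumes d: "V_topological_space tensor unit Y d" and "\<And>M. M \<in> set Ms \<Longrightarrow> N M \<subseteq> Y" "x \<in> Y"
  shows "d (\<Union>M\<in>set Ms. N M) x = (SUP M\<in>set Ms. d (N M) x)"
  using assms(2)
proof (induction Ms)
  case Nil
  then show ?case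
    using d \<open>x \<in> Y\<close> by (simp add: V_topological_space_def)
next
  case (Cons M Ms)
  moreover have "(\<Union>M\<in>set Ms. N M) \<subseteq> Y" "N M \<subseteq> Y"
    using Cons.prems by auto
  ultimately show ?case
    using d \<open>x \<in> Y\<close> by (auto simp: V_topological_space_def)
qed

end

section \<open>Topology axioms and universal property of \<open>closure_plus\<close>\<close>

lemma closure_plus_le:
  assumes "A \<subseteq> X" "x \<in> X" "Ms \<in> FinCov X A"
  shows "closure_plus X c A x \<le> (SUP M\<in>set Ms. c M x)"
  using assms by (auto simp: closure_plus_def intro: INF_lower)

text \<open>The one-term string \<open>[A]\<close> is among the covers over which the infimum is
  taken.\<close>

lemma closure_plus_le_closure:
  assumes "A \<subseteq> X" "x \<in> X"
  shows "closure_plus X c A x \<le> c A x"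
  using closure_plus_le[OF assms, of "[A]" c] assms(1) by (simp add: FinCov_def)

lemma closure_plus_greatest:
  assumes "A \<subseteq> X" "x \<in> X"
    and "\<And>Ms. Ms \<in> FinCov X A \<Longrightarrow> u \<le> (SUP M\<in>set Ms. c M x)"
  shows "u \<le> closure_plus X c A x"
  using assms by (auto simp: closure_plus_def intro: INF_greatest)

lemma FinCov_subset: "Ms \<in> FinCov X A \<Longrightarrow> M \<in> set Ms \<Longrightarrow> M \<subseteq> A \<and> M \<subseteq> X"
  by (auto simp: FinCov_def)

lemma closure_plus_transitive:
  fixes tensor :: "'v::complete_lattice \<Rightarrow> 'v \<Rightarrow> 'v"
  assumes q: "quantale tensor k"
    and gen: "\<forall>u::'v. \<exists>S. (\<forall>p\<in>S. coprime_element p) \<and> u = Sup S"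
    and c: "V_closure_space tensor k X c" and A: "A \<subseteq> X" and B: "B \<subseteq> X" and x: "x \<in> X"
  shows "tensor (INF y\<in>B. closure_plus X c A y) (closure_plus X c B x) \<le> closure_plus X c A x"
proof (rule closure_plus_greatest[OF A x])
  interpret quantale tensor k by fact
  fix Ms assume Ms: "Ms \<in> FinCov X A"
  obtain S where S: "\<forall>p\<in>S. coprime_element p" "(INF y\<in>B. closure_plus X c A y) = Sup S"
    using gen by blast
  \<comment> \<open>Since the tensor preserves suprema in its left variable, each coprime member of
    \<open>S\<close> can be treated separately.\<close>
  have "tensor p (closure_plus X c B x) \<le> (SUP M\<in>set Ms. c M x)" if "p \<in> S" for p
  proof -
    define N where "N M = {y\<in>B. p \<le> c M y}" for M
    have "\<exists>M\<in>set Ms. y \<in> N M" if "y \<in> B" for y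
    proof -
      have "p \<le> (INF y\<in>B. closure_plus X c A y)"
        using \<open>p \<in> S\<close> S(2) by (simp add: Sup_upper)
      also have "\<dots> \<le> closure_plus X c A y"
        using \<open>y \<in> B\<close> by (rule INF_lower)
      also have "\<dots> \<le> (SUP M\<in>set Ms. c M y)"
        using closure_plus_le[OF A _ Ms] B \<open>y \<in> B\<close> by blast
      finally show ?thesis
        using coprime_le_SUP_finite[of p "set Ms" "\<lambda>M. c M y"] S(1) \<open>p \<in> S\<close> \<open>y \<in> B\<close>
        by (auto simp: N_def)
    qed
    \<comment> \<open>Each \<open>N M\<close> is a subset of \<open>B\<close> by definition, and by
      the previous claim together they exhaust \<open>B\<close>, so the union is exactly
      \<open>B\<close>, as \<open>FinCov\<close> demands.\<close>
    then have "map N Ms \<in> FinCov X B"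
      using B by (fastforce simp: FinCov_def N_def)
    then have "tensor p (closure_plus X c B x) \<le> tensor p (SUP M\<in>set Ms. c (N M) x)"
      using closure_plus_le[OF B x, of "map N Ms" c] by (simp add: tensor_mono_right image_image)
    also have "\<dots> = (SUP M\<in>set Ms. tensor p (c (N M) x))"
      by (simp add: tensor_Sup_right image_image)
    also have "\<dots> \<le> (SUP M\<in>set Ms. c M x)"
    proof (rule SUP_subset_mono[OF subset_refl])
      fix M assume M: "M \<in> set Ms"
      have "p \<le> (INF y\<in>N M. c M y)"
        by (auto simp: N_def intro: INF_greatest)
      then have "tensor p (c (N M) x) \<le> tensor (INF y\<in>N M. c M y) (c (N M) x)"
        by (rule tensor_mono_left)
      also have "\<dots> \<le> c M x"
        using x B FinCov_subset[OF Ms M]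
        by (intro V_closure_space_transitive[OF c]) (auto simp: N_def)
      finally show "tensor p (c (N M) x) \<le> c M x" .
    qed
    finally show ?thesis .
  qed
  then show "tensor (INF y\<in>B. closure_plus X c A y) (closure_plus X c B x)
      \<le> (SUP M\<in>set Ms. c M x)"
    by (auto simp: S(2) tensor_Sup_left intro: SUP_least)
qed

text \<open>Intersecting its terms with \<open>A\<close> turns a cover of \<open>B\<close> into a
  cover of \<open>A\<close>, and monotonicity of \<open>c\<close> compares the two suprema term by
  term.\<close>

lemma closure_plus_mono:
  assumes "quantale tensor k" "V_closure_space tensor k X c" "A \<subseteq> B" "B \<subseteq> X" "x \<in> X"
  shows "closure_plus X c A x \<le> closure_plus X c B x"
proof (rule closure_plus_greatest[OF assms(4,5)])
  fix Ms assume Ms: "Ms \<in> FinCov X B"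
  then have "map ((\<inter>) A) Ms \<in> FinCov X A"
    using assms(3,4) by (fastforce simp: FinCov_def)
  then have "closure_plus X c A x \<le> (SUP M\<in>set Ms. c (A \<inter> M) x)"
    using closure_plus_le[of A X x "map ((\<inter>) A) Ms" c] assms by (auto simp: image_image)
  also have "\<dots> \<le> (SUP M\<in>set Ms. c M x)"
    using FinCov_subset[OF Ms] assms
    by (intro SUP_subset_mono quantale.closure_mono[OF assms(1,2)]) auto
  finally show "closure_plus X c A x \<le> (SUP M\<in>set Ms. c M x)" .
qed

text \<open>If a coprime \<open>p\<close> below the left side were below neither summand, some cover
  of \<open>A\<close> and some cover of \<open>B\<close> would both have suprema not above
  \<open>p\<close>. Their concatenation covers \<open>A \<union> B\<close>, so \<open>p\<close> is
  below the join of these two suprema, which contradicts coprimality.\<close>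

lemma closure_plus_union_le:
  fixes c :: "'a set \<Rightarrow> 'a \<Rightarrow> 'v::complete_lattice"
  assumes gen: "\<forall>u::'v. \<exists>S. (\<forall>p\<in>S. coprime_element p) \<and> u = Sup S"
    and A: "A \<subseteq> X" and B: "B \<subseteq> X" and x: "x \<in> X"
  shows "closure_plus X c (A \<union> B) x \<le> sup (closure_plus X c A x) (closure_plus X c B x)"
proof (rule le_by_coprimes[OF gen])
  fix p assume p: "coprime_element p" "p \<le> closure_plus X c (A \<union> B) x"
  show "p \<le> sup (closure_plus X c A x) (closure_plus X c B x)"
  proof (rule ccontr)
    assume "\<not> p \<le> sup (closure_plus X c A x) (closure_plus X c B x)"
    then have "\<not> p \<le> closure_plus X c A x" "\<not> p \<le> closure_plus X c B x"
      by (auto intro: le_supI1 le_supI2)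
    then obtain Ms Ns where *: "Ms \<in> FinCov X A" "\<not> p \<le> (SUP M\<in>set Ms. c M x)"
        "Ns \<in> FinCov X B" "\<not> p \<le> (SUP M\<in>set Ns. c M x)"
      using closure_plus_greatest[OF A x] closure_plus_greatest[OF B x] by metis
    then have "Ms @ Ns \<in> FinCov X (A \<union> B)"
      by (auto simp: FinCov_def)
    then have "p \<le> sup (SUP M\<in>set Ms. c M x) (SUP M\<in>set Ns. c M x)"
      using closure_plus_le[of "A \<union> B" X x "Ms @ Ns" c] p(2) A B x
      by (auto simp: SUP_union intro: order_trans)
    then show False
      using p(1) * by (auto simp: coprime_element_def)
  qed
qed

proposition closure_plus_topological:
  fixes tensor :: "'v::complete_lattice \<Rightarrow> 'v \<Rightarrow> 'v"
  assumes q: "quantale tensor k"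
    and gen: "\<forall>u::'v. \<exists>S. (\<forall>p\<in>S. coprime_element p) \<and> u = Sup S"
    and c: "V_closure_space tensor k X c"
  shows "V_topological_space tensor k X (closure_plus X c)"
  unfolding V_topological_space_def
proof (intro conjI allI impI ballI)
  have "k \<le> closure_plus X c A x" if "A \<subseteq> X" "x \<in> A" for A x
  proof (rule closure_plus_greatest)
    fix Ms assume Ms: "Ms \<in> FinCov X A"
    \<comment> \<open>Every cover of \<open>A\<close> has a term containing \<open>x\<close>;
      reflexivity of \<open>c\<close> at that single term already bounds the supremum.\<close>
    then obtain M where "M \<in> set Ms" "x \<in> M"
      using \<open>x \<in> A\<close> by (auto simp: FinCov_def)
    moreover from this have "k \<le> c M x"
      using V_closure_space_reflexive[OF c] FinCov_subset[OF Ms] by blast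
    ultimately show "k \<le> (SUP M\<in>set Ms. c M x)"
      by (meson SUP_upper2)
  qed (use that in auto)
  then show "V_closure_space tensor k X (closure_plus X c)"
    unfolding V_closure_space_def
    using closure_plus_transitive[OF q gen c] by (auto simp: closure_plus_def)
next
  fix x assume "x \<in> X"
  then show "closure_plus X c {} x = bot"
    \<comment> \<open>The empty string covers \<open>{}\<close> and contributes the supremum
      \<open>bot\<close>.\<close>
    using closure_plus_le[of "{}" X x "[]" c] by (simp add: FinCov_def bot_unique)
next
  fix A B x assume "A \<subseteq> X" "B \<subseteq> X" "x \<in> X"
  then show "closure_plus X c (A \<union> B) x = sup (closure_plus X c A x) (closure_plus X c B x)"
    by (intro antisym closure_plus_union_le[OF gen] sup_least closure_plus_mono[OF q c]) auto
qed

proposition continuous_closure_plus: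
  assumes q: "quantale tensor k"
    and d: "V_topological_space tensor k Y d"
    and g: "V_continuous Y d X c g"
  shows "V_continuous Y d X (closure_plus X c) g"
  unfolding V_continuous_def
proof (intro conjI allI impI)
  show gYX: "g \<in> Y \<rightarrow>\<^sub>E X"
    using g by (simp add: V_continuous_def)
  fix A x assume A: "A \<subseteq> Y" and x: "x \<in> Y"
  have gA: "g ` A \<subseteq> X" and gx: "g x \<in> X"
    using gYX A x by auto
  show "d A x \<le> closure_plus X c (g ` A) (g x)"
  proof (rule closure_plus_greatest[OF gA gx])
    fix Ms assume Ms: "Ms \<in> FinCov X (g ` A)"
    define N where "N M = {y\<in>A. g y \<in> M}" for M
    have "A = (\<Union>M\<in>set Ms. N M)"
      using Ms by (auto simp: FinCov_def N_def)
    then have "d A x = d (\<Union>M\<in>set Ms. N M) x"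
      by simp
    also have "\<dots> = (SUP M\<in>set Ms. d (N M) x)"
      using A x by (intro quantale.topological_finite_additive[OF q d]) (auto simp: N_def)
    also have "\<dots> \<le> (SUP M\<in>set Ms. c M (g x))"
    proof (rule SUP_subset_mono[OF subset_refl])
      fix M assume "M \<in> set Ms"
      then have "g ` N M = M"
        using FinCov_subset[OF Ms] by (auto simp: N_def)
      moreover have "N M \<subseteq> Y"
        using A by (auto simp: N_def)
      ultimately show "d (N M) x \<le> c M (g x)"
        using g x by (metis V_continuous_def)
    qed
    finally show "d A x \<le> (SUP M\<in>set Ms. c M (g x))" .
  qed
qed

section \<open>Continuous maps and the categories of spaces\<close>

lemma continuous_PiE: "V_continuous X c Y d f \<Longrightarrow> f \<in> X \<rightarrow>\<^sub>E Y"
  by (simp add: V_continuous_def)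

lemma continuous_ident:
  assumes "\<And>A x. A \<subseteq> X \<Longrightarrow> x \<in> X \<Longrightarrow> c A x \<le> d A x"
  shows "V_continuous X c X d (\<lambda>x\<in>X. x)"
proof -
  have "(\<lambda>x\<in>X. x) ` A = A" if "A \<subseteq> X" for A
    using that by force
  then show ?thesis
    using assms by (auto simp: V_continuous_def)
qed

lemma continuous_closure_plus_ident: "V_continuous X (closure_plus X c) X c (\<lambda>x\<in>X. x)"
  by (rule continuous_ident) (rule closure_plus_le_closure)

lemma continuous_compose:
  assumes f: "V_continuous X c Y d f" and g: "V_continuous Y d Z e g"
  shows "V_continuous X c Z e (compose X g f)"
  unfolding V_continuous_def
proof (intro conjI allI impI)
  have fXY: "f \<in> X \<rightarrow>\<^sub>E Y" and gYZ: "g \<in> Y \<rightarrow>\<^sub>E Z"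
    using f g by (auto simp: V_continuous_def)
  then show "compose X g f \<in> X \<rightarrow>\<^sub>E Z"
    by (auto simp: compose_def)
  fix A x assume A: "A \<subseteq> X" and x: "x \<in> X"
  have "c A x \<le> d (f ` A) (f x)"
    using f A x by (simp add: V_continuous_def)
  also have "\<dots> \<le> e (g ` f ` A) (g (f x))"
  proof -
    have "f ` A \<subseteq> Y" "f x \<in> Y"
      using fXY A x by auto
    then show ?thesis
      using g by (simp add: V_continuous_def)
  qed
  also have "g ` f ` A = compose X g f ` A"
    using A by (force simp: compose_def)
  also have "g (f x) = compose X g f x"
    using x by (simp add: compose_def)
  finally show "c A x \<le> e (compose X g f ` A) (compose X g f x)" .
qed

lemma compose_ident_right: "f \<in> X \<rightarrow>\<^sub>E Y \<Longrightarrow> compose X f (\<lambda>x\<in>X. x) = f"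
  by (auto simp: PiE_def intro: compose_Id)

lemma compose_ident_left: "f \<in> X \<rightarrow>\<^sub>E Y \<Longrightarrow> compose X (\<lambda>y\<in>Y. y) f = f"
  by (auto simp: PiE_def intro: Id_compose)

lemma compose_in_PiE: "f \<in> X \<rightarrow>\<^sub>E Y \<Longrightarrow> g \<in> Y \<rightarrow>\<^sub>E Z \<Longrightarrow> compose X g f \<in> X \<rightarrow>\<^sub>E Z"
  by (auto simp: compose_def)

lemma compose_assoc_PiE:
  "f \<in> X \<rightarrow>\<^sub>E Y \<Longrightarrow> compose X h (compose X g f) = compose X (compose Y h g) f"
  by (rule compose_assoc) auto

lemma category_Set: "category Set_cat"
  by unfold_locales
    (simp_all add: Set_cat_def compose_ident_right compose_ident_left compose_in_PiE
      compose_assoc_PiE)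

lemma V_Cls_simps [simp]:
  "Obj (V_Cls tensor k) = {(X, c). V_closure_space tensor k X c}"
  "Hom (V_Cls tensor k) (X, c) (Y, d) = {f. V_continuous X c Y d f}"
  "Ident (V_Cls tensor k) (X, c) = (\<lambda>x\<in>X. x)"
  "Comp (V_Cls tensor k) (X, c) S T g f = compose X g f"
  by (simp_all add: V_Cls_def)

lemma category_V_Cls: "category (V_Cls tensor k)"
  by unfold_locales
    (auto simp: continuous_ident intro: compose_ident_right[OF continuous_PiE]
      compose_ident_left[OF continuous_PiE] continuous_compose compose_assoc_PiE[OF continuous_PiE])

lemma V_Top_simps [simp]:
  "Obj (V_Top tensor k) = {(X, c). V_topological_space tensor k X c}"
  "Hom (V_Top tensor k) = Hom (V_Cls tensor k)"
  "Ident (V_Top tensor k) = Ident (V_Cls tensor k)"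
  "Comp (V_Top tensor k) = Comp (V_Cls tensor k)"
  by (simp_all add: V_Top_def)

text \<open>The category axioms quantify universally over objects and leave the hom-sets untouched
  here, so they restrict to any smaller class of objects.\<close>

lemma category_full_subcategory:
  assumes "category C" "Ob \<subseteq> Obj C"
  shows "category (C\<lparr>Obj := Ob\<rparr>)"
proof -
  interpret category C by fact
  show ?thesis
    using assms(2)
    by unfold_locales
      (auto simp: subset_iff ident_in_hom comp_ident_right comp_ident_left
        intro: comp_in_hom comp_assoc)
qed

lemma category_V_Top: "category (V_Top tensor k)"
  unfolding V_Top_def
  by (rule category_full_subcategory[OF category_V_Cls]) (auto simp: V_topological_space_def)

section \<open>Functors and the adjunction\<close>

lemma underlying_functor_V_Cls: "is_functor (V_Cls tensor k) Set_cat underlying_functor"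
  by (intro is_functor.intro is_functor_axioms.intro category_V_Cls category_Set)
    (auto simp: underlying_functor_def Set_cat_def V_continuous_def)

lemma underlying_functor_V_Top: "is_functor (V_Top tensor k) Set_cat underlying_functor"
  by (intro is_functor.intro is_functor_axioms.intro category_V_Top category_Set)
    (auto simp: underlying_functor_def Set_cat_def V_continuous_def)

lemma inclusion_functor_V_Top: "is_functor (V_Top tensor k) (V_Cls tensor k) inclusion_functor"
  by (intro is_functor.intro is_functor_axioms.intro category_V_Top category_V_Cls)
    (auto simp: inclusion_functor_def V_topological_space_def)

lemma is_functor_id: "category C \<Longrightarrow> is_functor C C id_functor"
  by (intro is_functor.intro is_functor_axioms.intro) (auto simp: id_functor_def)

lemma is_functor_comp:
  assumes "is_functor C D F" "is_functor D E G"
  shows "is_functor C E (comp_functor G F)"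
proof -
  interpret F: is_functor C D F by fact
  interpret G: is_functor D E G by fact
  show ?thesis
    by unfold_locales
      (auto simp: comp_functor_def F.FObj_in G.FObj_in F.FMor_in G.FMor_in F.FMor_ident
        G.FMor_ident F.FMor_comp G.FMor_comp)
qed

text \<open>The content is that \<open>f\<close> stays continuous for the new structures.
  Precomposing with the identity from \<open>closure_plus X c\<close> to \<open>c\<close> gives
  continuity into \<open>d\<close>, and the universal property lifts this to
  \<open>closure_plus Y d\<close>, because the new domain is topological.\<close>

lemma plus_functor_V_Cls:
  fixes tensor :: "'v::complete_lattice \<Rightarrow> 'v \<Rightarrow> 'v"
  assumes q: "quantale tensor k"
    and gen: "\<forall>u::'v. \<exists>S. (\<forall>p\<in>S. coprime_element p) \<and> u = Sup S"
  shows "is_functor (V_Cls tensor k) (V_Top tensor k) plus_functor"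
proof (intro is_functor.intro is_functor_axioms.intro category_V_Cls category_V_Top)
  fix S T :: "('a, 'v) space" and f
  assume *: "S \<in> Obj (V_Cls tensor k)" "T \<in> Obj (V_Cls tensor k)" "f \<in> Hom (V_Cls tensor k) S T"
  obtain X c Y d where ST: "S = (X, c)" "T = (Y, d)"
    by (cases S, cases T)
  have "V_continuous X (closure_plus X c) Y d (compose X f (\<lambda>x\<in>X. x))"
    using * by (intro continuous_compose[OF continuous_closure_plus_ident]) (simp add: ST)
  moreover have "compose X f (\<lambda>x\<in>X. x) = f"
    using * by (intro compose_ident_right continuous_PiE) (simp add: ST)
  ultimately have "V_continuous X (closure_plus X c) Y (closure_plus Y d) f"
    using continuous_closure_plus[OF q closure_plus_topological[OF q gen]] * by (simp add: ST)
  then show "FMor plus_functor S T f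
      \<in> Hom (V_Top tensor k) (FObj plus_functor S) (FObj plus_functor T)"
    by (simp add: plus_functor_def ST)
qed (auto simp: plus_functor_def closure_plus_topological[OF q gen])

text \<open>Unit and counit both consist of identity maps, so naturality and the triangle equations
  reduce to identity laws of composition; only continuity of the components carries content.\<close>

lemma plus_functor_adjunction:
  fixes tensor :: "'v::complete_lattice \<Rightarrow> 'v \<Rightarrow> 'v"
  assumes q: "quantale tensor k"
    and gen: "\<forall>u::'v. \<exists>S. (\<forall>p\<in>S. coprime_element p) \<and> u = Sup S"
  shows "adjunction (V_Top tensor k) (V_Cls tensor k) inclusion_functor plus_functor
    (\<lambda>(X, c). \<lambda>x\<in>X. x) (\<lambda>(X, c). \<lambda>x\<in>X. x)"
proof -
  note incl = inclusion_functor_V_Top[of tensor k] and plus = plus_functor_V_Cls[OF q gen]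
  note functors = incl plus is_functor_comp[OF incl plus] is_functor_comp[OF plus incl]
    is_functor_id[OF category_V_Top] is_functor_id[OF category_V_Cls]
  note defs = id_functor_def comp_functor_def inclusion_functor_def plus_functor_def
  note compose_ident = compose_ident_right[OF continuous_PiE] compose_ident_left[OF continuous_PiE]
  \<comment> \<open>The universal property applied to the identity of a topological space. With
    \<open>closure_plus_le_closure\<close> it says that \<open>closure_plus\<close> fixes
    topological structures.\<close>
  have unit: "V_continuous X c X (closure_plus X c) (\<lambda>x\<in>X. x)"
    if "V_topological_space tensor k X c" for X :: "'a set" and c
    by (rule continuous_closure_plus[OF q that]) (simp add: continuous_ident)
  have "natural_transformation (V_Top tensor k) (V_Top tensor k) id_functor
      (comp_functor plus_functor (inclusion_functor :: (('a, 'v) space, _, _, _) ftor))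
      (\<lambda>(X, c). \<lambda>x\<in>X. x)"
    by (intro natural_transformation.intro natural_transformation_axioms.intro functors)
      (auto simp: defs unit compose_ident)
  moreover have "natural_transformation (V_Cls tensor k) (V_Cls tensor k)
      (comp_functor (inclusion_functor :: (('a, 'v) space, _, _, _) ftor) plus_functor) id_functor
      (\<lambda>(X, c). \<lambda>x\<in>X. x)"
    by (intro natural_transformation.intro natural_transformation_axioms.intro functors)
      (auto simp: defs continuous_closure_plus_ident compose_ident)
  moreover have "compose X (\<lambda>x\<in>X. x) (\<lambda>x\<in>X. x) = (\<lambda>x\<in>X. x)" for X :: "'a set"
    by (auto simp: compose_def)
  ultimately show ?thesis
    by (intro adjunction.intro adjunction_axioms.intro functors) (auto simp: defs)
qed

theorem theorem4p2:
  fixes tensor :: "'v::complete_lattice \<Rightarrow> 'v \<Rightarrow> 'v" and k :: 'v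
  assumes "quantale tensor k"
    and "\<forall>u::'v. \<exists>S. (\<forall>p\<in>S. coprime_element p) \<and> u = Sup S"
  shows
    "is_functor (V_Cls tensor k :: (('a, 'v) space, 'a \<Rightarrow> 'a) cat) (V_Top tensor k) plus_functor \<and>
     (\<exists>\<eta>. adjunction (V_Top tensor k :: (('a, 'v) space, 'a \<Rightarrow> 'a) cat) (V_Cls tensor k)
            inclusion_functor plus_functor \<eta> (\<lambda>(X, c). \<lambda>x\<in>X. x)) \<and>
     is_functor (V_Cls tensor k :: (('a, 'v) space, 'a \<Rightarrow> 'a) cat) Set_cat underlying_functor \<and>
     is_functor (V_Top tensor k :: (('a, 'v) space, 'a \<Rightarrow> 'a) cat) Set_cat underlying_functor \<and>
     functor_eq (V_Cls tensor k :: (('a, 'v) space, 'a \<Rightarrow> 'a) cat)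
       (comp_functor underlying_functor plus_functor) underlying_functor \<and>
     (\<forall>(X :: 'a set) c. V_closure_space tensor k X c \<longrightarrow>
       V_topological_space tensor k X (closure_plus X c) \<and>
       (\<forall>A x. A \<subseteq> X \<longrightarrow> x \<in> X \<longrightarrow> closure_plus X c A x \<le> c A x) \<and>
       V_continuous X (closure_plus X c) X c (\<lambda>x\<in>X. x) \<and>
       (\<forall>(Y :: 'b set) d g. V_topological_space tensor k Y d \<longrightarrow> V_continuous Y d X c g \<longrightarrow>
          V_continuous Y d X (closure_plus X c) g))"
proof (intro conjI allI impI exI)
  note q = assms(1) and gen = assms(2)
  show "is_functor (V_Cls tensor k :: (('a, 'v) space, 'a \<Rightarrow> 'a) cat) (V_Top tensor k) plus_functor"
    by (rule plus_functor_V_Cls[OF q gen])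
  \<comment> \<open>The existentially quantified unit is instantiated with the identity
    maps.\<close>
  show "adjunction (V_Top tensor k :: (('a, 'v) space, 'a \<Rightarrow> 'a) cat) (V_Cls tensor k)
      inclusion_functor plus_functor (\<lambda>(X, c). \<lambda>x\<in>X. x) (\<lambda>(X, c). \<lambda>x\<in>X. x)"
    by (rule plus_functor_adjunction[OF q gen])
  show "functor_eq (V_Cls tensor k :: (('a, 'v) space, 'a \<Rightarrow> 'a) cat)
      (comp_functor underlying_functor plus_functor) underlying_functor"
    by (auto simp: functor_eq_def comp_functor_def underlying_functor_def plus_functor_def)
\<comment> \<open>In the explicit universal property \<open>Y\<close> lives over its own type
  \<open>'b\<close>, so it comes from \<open>continuous_closure_plus\<close>, which allows different
  point types, and not from the adjunction over \<open>'a\<close>.\<close>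
qed (auto intro: underlying_functor_V_Cls underlying_functor_V_Top closure_plus_le_closure
    continuous_closure_plus_ident closure_plus_topological[OF assms] continuous_closure_plus[OF assms(1)])

end
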